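(* Let $\mathcal{A}>0$, $\mathcal{C}>0$ and $\gamma\in\left(\frac{\pi}{2},\pi\right]$, and let $\hat F_T:[0,\pi]\to\mathbb{R}$ be the dimensionless total force defined in the context. Then $\hat F_T$ admits at most two equilibrium points. If there are two, $\bar\phi_{01}<\bar\phi_{02}$, then the smaller one $\bar\phi_{01}$ is stable, the larger one $\bar\phi_{02}$ is unstable, and $\bar\phi_{02}\in\left(\frac{\pi}{2},\pi\right]$. If $\hat F_T$ admits only one equilibrium point $\bar\phi_0$, then $\bar\phi_0$ is stable if $\frac{d\hat F_T}{d\phi_0}(\bar\phi_0)>0$, and it is unstable if $\frac{d\hat F_T}{d\phi_0}(\bar\phi_0)=0$.
   Context: For parameters $\mathcal{A}>0$, $\mathcal{C}>0$ and contact angle $\gamma\in[0,\pi]$, the dimensionless total force on the floating cylinder, as a function of the wetting angle $\phi_0\in[0,\pi]$, is $$\hat F_T(\phi_0)=-\mathcal{A}\mathcal{C}^2-2\sin(\phi_0+\gamma)-4\mathcal{C}\cos\left(\frac{\phi_0+\gamma}{2}\right)\sin\phi_0-\frac12\mathcal{C}^2\sin 2\phi_0+\mathcal{C}^2\phi_0.$$ The total energy, divided by the positive constant $\sigma a$ (surface tension times radius), is $$\begin{aligned}\hat E_T(\phi_0)={}&\mathcal{A}\mathcal{C}^2\left[\cos\phi_0+\tfrac{2}{\mathcal{C}}\cos\left(\tfrac{\phi_0+\gamma}{2}\right)\right]-2\phi_0\cos\gamma+\tfrac{8}{3\mathcal{C}}\left[1-\sin^3\left(\tfrac{\phi_0+\gamma}{2}\right)\right]+2\sin\phi_0\cos(\phi_0+\gamma)\\&+\mathcal{C}^2\left[\tfrac1{12}\sin3\phi_0-\phi_0\cos\phi_0+\tfrac34\sin\phi_0\right]+\mathcal{C}\cos\left(\tfrac{\phi_0+\gamma}{2}\right)\left[\sin2\phi_0-2\phi_0\right].\end{aligned}$$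 An equilibrium point is a $\bar\phi_0\in[0,\pi]$ with $\hat F_T(\bar\phi_0)=0$. An equilibrium point is called stable if it is a strict local minimum of $\hat E_T$ on $[0,\pi]$, and unstable if it is not a local minimum of $\hat E_T$ on $[0,\pi]$. *)

theory Defs
  imports "HOL-Analysis.Analysis"
begin

text \<open>
  The force and the energy are given by formulas that make sense on the whole real line;
  the domain \<open>[0, \<pi>]\<close> of the wetting angle \<open>\<phi>\<close> enters through \<open>equilibria\<close> and through the
  set on which local minima are taken. Since the formulas are smooth on the line, \<open>deriv\<close> agrees
  with the one-sided derivative at the end points.
\<close>

definition force :: "real \<Rightarrow> real \<Rightarrow> real \<Rightarrow> real \<Rightarrow> real" where
  "force A C \<gamma> \<phi> =
     - A * C\<^sup>2 - 2 * sin (\<phi> + \<gamma>) - 4 * C * cos ((\<phi> + \<gamma>) / 2) * sin \<phi>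
     - 1 / 2 * C\<^sup>2 * sin (2 * \<phi>) + C\<^sup>2 * \<phi>"

text \<open>Total energy divided by surface tension times radius.\<close>

definition energy :: "real \<Rightarrow> real \<Rightarrow> real \<Rightarrow> real \<Rightarrow> real" where
  "energy A C \<gamma> \<phi> =
     A * C\<^sup>2 * (cos \<phi> + 2 / C * cos ((\<phi> + \<gamma>) / 2)) - 2 * \<phi> * cos \<gamma>
     + 8 / (3 * C) * (1 - sin ((\<phi> + \<gamma>) / 2) ^ 3) + 2 * sin \<phi> * cos (\<phi> + \<gamma>)
     + C\<^sup>2 * (1 / 12 * sin (3 * \<phi>) - \<phi> * cos \<phi> + 3 / 4 * sin \<phi>)
     + C * cos ((\<phi> + \<gamma>) / 2) * (sin (2 * \<phi>) - 2 * \<phi>)"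

definition equilibria :: "real \<Rightarrow> real \<Rightarrow> real \<Rightarrow> real set" where
  "equilibria A C \<gamma> = {\<phi> \<in> {0..pi}. force A C \<gamma> \<phi> = 0}"

definition local_min_on :: "real set \<Rightarrow> (real \<Rightarrow> real) \<Rightarrow> real \<Rightarrow> bool" where
  "local_min_on S f x \<longleftrightarrow> x \<in> S \<and> (\<forall>\<^sub>F y in at x within S. f x \<le> f y)"

definition strict_local_min_on :: "real set \<Rightarrow> (real \<Rightarrow> real) \<Rightarrow> real \<Rightarrow> bool" where
  "strict_local_min_on S f x \<longleftrightarrow> x \<in> S \<and> (\<forall>\<^sub>F y in at x within S. f x < f y)"

definition stable_equilibrium :: "real \<Rightarrow> real \<Rightarrow> real \<Rightarrow> real \<Rightarrow> bool" where
  "stable_equilibrium A C \<gamma> \<phi> \<longleftrightarrow>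
     \<phi> \<in> equilibria A C \<gamma> \<and> strict_local_min_on {0..pi} (energy A C \<gamma>) \<phi>"

definition unstable_equilibrium :: "real \<Rightarrow> real \<Rightarrow> real \<Rightarrow> real \<Rightarrow> bool" where
  "unstable_equilibrium A C \<gamma> \<phi> \<longleftrightarrow>
     \<phi> \<in> equilibria A C \<gamma> \<and> \<not> local_min_on {0..pi} (energy A C \<gamma>) \<phi>"

end

theory Submission
  imports Defs
begin

text \<open>
  The energy satisfies \<open>E' = F \<cdot> (sin \<phi> + sin ((\<phi> + \<gamma>) / 2) / C)\<close> with a second factor that is
  positive on \<open>(0, \<pi>)\<close>, so \<open>E\<close> increases where \<open>F > 0\<close> and decreases where \<open>F < 0\<close>. For
  \<open>\<gamma> > \<pi>/2\<close> the derivative \<open>F'\<close> is strictly increasing on \<open>[0, \<pi> - \<gamma>]\<close>, positive on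
  \<open>[\<pi> - \<gamma>, \<pi>/2]\<close> and strictly decreasing on \<open>[\<pi>/2, \<pi>]\<close> with \<open>F' \<pi> < 0\<close>. As \<open>F 0 < 0\<close>, there
  are \<open>a < \<pi>/2 < b < \<pi>\<close> such that \<open>F\<close> is negative on \<open>[0, a]\<close>, strictly increasing on \<open>[a, b]\<close> and
  strictly decreasing on \<open>[b, \<pi>]\<close>. Equilibria left of \<open>b\<close> are then stable, the others unstable.
\<close>

section \<open>Derivatives of the force and of the energy\<close>

text \<open>The derivative of \<open>force\<close> with
  \<open>C\<^sup>2 - C\<^sup>2 * cos (2 * \<phi>)\<close> rewritten by the double angle formula.
  Once reassociated, its three summands have an evident sign or monotonicity on suitable ranges, and
  \<open>linarith\<close> adds them up as atoms.\<close>

definition force' :: "real \<Rightarrow> real \<Rightarrow> real \<Rightarrow> real" where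
  "force' C \<gamma> \<phi> = - 2 * cos (\<phi> + \<gamma>) + 2 * (C\<^sup>2 * (sin \<phi>)\<^sup>2)
     + 2 * C * (sin ((\<phi> + \<gamma>) / 2) * sin \<phi> - 2 * (cos ((\<phi> + \<gamma>) / 2) * cos \<phi>))"

lemma DERIV_force: "(force A C \<gamma> has_real_derivative force' C \<gamma> x) (at x)"
proof -
  have *: "C\<^sup>2 * cos (x * 2) = C\<^sup>2 - 2 * (C\<^sup>2 * (sin x)\<^sup>2)"
    using cos_double_sin [of x] by (simp add: mult.commute [of x] right_diff_distrib)
  show ?thesis
    unfolding force_def [abs_def] force'_def
    by (auto intro!: derivative_eq_intros simp: algebra_simps add_divide_distrib diff_divide_distrib *)
qed

lemma deriv_force: "deriv (force A C \<gamma>) x = force' C \<gamma> x"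
  by (rule DERIV_imp_deriv [OF DERIV_force])

text \<open>In terms of the half angle \<open>s\<close>, with \<gamma> = 2s - x, all trigonometric
  terms become polynomials in the sines and cosines of x and s. The claimed factorisation is then a
  polynomial identity modulo \<open>p\<^sup>2 + q\<^sup>2 = 1\<close>.\<close>

lemma DERIV_energy:
  assumes "C \<noteq> 0"
  shows "(energy A C \<gamma> has_real_derivative
    force A C \<gamma> x * (sin x + sin ((x + \<gamma>) / 2) / C)) (at x)"
proof -
  define s where "s = (x + \<gamma>) / 2"
  define p q c t where "p = sin x" and "q = cos x" and "c = cos s" and "t = sin s"
  have pq: "p\<^sup>2 + q\<^sup>2 = 1"
    by (simp add: p_def q_def)
  have sum: "x + \<gamma> = 2 * s"
    by (simp add: s_def)
  have s2: "sin (2 * s) = 2 * t * c" "cos (2 * s) = c\<^sup>2 - t\<^sup>2"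
    by (simp_all add: t_def c_def sin_double cos_double)
  have x2: "sin (2 * x) = 2 * p * q" "cos (2 * x) = q\<^sup>2 - p\<^sup>2"
    by (simp_all add: p_def q_def sin_double cos_double)
  have x3: "cos (3 * x) = (q\<^sup>2 - p\<^sup>2) * q - 2 * p * q * p"
    using cos_add [of "2 * x" x] x2 by (simp add: p_def q_def)
  have "2 * s - x = \<gamma>"
    using sum by simp
  then have g: "cos \<gamma> = (c\<^sup>2 - t\<^sup>2) * q + 2 * t * c * p"
    using cos_diff [of "2 * s" x] s2 by (simp add: p_def q_def)
  have "(energy A C \<gamma> has_real_derivative
      A * C\<^sup>2 * (- p - t / C) - 2 * cos \<gamma> - 4 / C * t\<^sup>2 * c
      + 2 * q * cos (x + \<gamma>) - 2 * p * sin (x + \<gamma>)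
      + C\<^sup>2 * (1 / 4 * cos (3 * x) - q + x * p + 3 / 4 * q)
      - C * t / 2 * (sin (2 * x) - 2 * x) + C * c * (2 * cos (2 * x) - 2)) (at x)"
    unfolding energy_def [abs_def]
    by (rule derivative_eq_intros refl | simp)+
      (use assms in \<open>simp add: s_def p_def q_def c_def t_def field_simps power2_eq_square\<close>)
  moreover have "A * C\<^sup>2 * (- p - t / C) - 2 * cos \<gamma> - 4 / C * t\<^sup>2 * c
      + 2 * q * cos (x + \<gamma>) - 2 * p * sin (x + \<gamma>)
      + C\<^sup>2 * (1 / 4 * cos (3 * x) - q + x * p + 3 / 4 * q)
      - C * t / 2 * (sin (2 * x) - 2 * x) + C * c * (2 * cos (2 * x) - 2)
     = force A C \<gamma> x * (p + t / C)"
  proof -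
    \<comment> \<open>Treating 1/C as an independent variable makes the identity below purely
      polynomial. The difference of the two sides is written with explicit cofactors of
      \<open>p\<^sup>2 + q\<^sup>2 - 1\<close> and \<open>C * i - 1\<close>, both of which
      vanish.\<close>
    define i where "i = 1 / C"
    have "A * C\<^sup>2 * (- p - t * i) - 2 * ((c\<^sup>2 - t\<^sup>2) * q + 2 * t * c * p) - 4 * i * t\<^sup>2 * c
      + 2 * q * (c\<^sup>2 - t\<^sup>2) - 2 * p * (2 * t * c)
      + C\<^sup>2 * (1 / 4 * ((q\<^sup>2 - p\<^sup>2) * q - 2 * p * q * p) - q + x * p + 3 / 4 * q)
      - C * t / 2 * (2 * p * q - 2 * x) + C * c * (2 * (q\<^sup>2 - p\<^sup>2) - 2)
     - (- A * C\<^sup>2 - 2 * (2 * t * c) - 4 * C * c * p - 1 / 2 * C\<^sup>2 * (2 * p * q) + C\<^sup>2 * x)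
       * (p + t * i)
     = (2 * C * c + C\<^sup>2 * q / 4) * (p\<^sup>2 + q\<^sup>2 - 1) + (4 * c * p * t - C * t * (x - p * q)) * (C * i - 1)"
      by (simp add: field_simps power2_eq_square)
    also have "\<dots> = 0"
      using assms pq by (simp add: i_def)
    finally show ?thesis
      unfolding force_def sum s2 x2 x3 g i_def by (simp add: p_def q_def c_def t_def)
  qed
  ultimately show ?thesis
    by (simp add: p_def t_def s_def)
qed

section \<open>Monotonicity of the energy from the sign of the force\<close>

text \<open>Both x and (x + \<gamma>)/2 lie strictly between 0 and pi. The interval is open because
  for \<gamma> = pi the sum vanishes at x = pi.\<close>

lemma energy_factor_pos:
  assumes "0 < C" "pi / 2 < \<gamma>" "\<gamma> \<le> pi" "0 < x" "x < pi"
  shows "0 < sin x + sin ((x + \<gamma>) / 2) / C"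
proof -
  have "0 < sin x" "0 < sin ((x + \<gamma>) / 2)"
    using assms by (auto intro!: sin_gt_zero)
  with \<open>0 < C\<close> show ?thesis
    by (simp add: add_pos_pos)
qed

lemma continuous_on_energy:
  assumes "C \<noteq> 0"
  shows "continuous_on S (energy A C \<gamma>)"
  by (intro continuous_at_imp_continuous_on ballI DERIV_isCont [OF DERIV_energy [OF assms]])

text \<open>The sign of the force is required only inside the interval, so an end point may be an
  equilibrium or the point pi, where the second factor of the derivative can vanish.\<close>

lemma energy_increasing:
  assumes "0 < C" "pi / 2 < \<gamma>" "\<gamma> \<le> pi" "0 \<le> u" "u < v" "v \<le> pi"
    and "\<And>x. u < x \<Longrightarrow> x < v \<Longrightarrow> 0 < force A C \<gamma> x"
  shows "energy A C \<gamma> u < energy A C \<gamma> v"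
proof (rule DERIV_pos_imp_increasing_open [OF \<open>u < v\<close>])
  fix x assume "u < x" "x < v"
  with assms have "0 < force A C \<gamma> x * (sin x + sin ((x + \<gamma>) / 2) / C)"
    by (intro mult_pos_pos energy_factor_pos) auto
  then show "\<exists>y. (energy A C \<gamma> has_real_derivative y) (at x) \<and> 0 < y"
    using DERIV_energy assms(1) by (metis less_irrefl)
qed (use assms(1) in \<open>auto intro: continuous_on_energy\<close>)

lemma energy_decreasing:
  assumes "0 < C" "pi / 2 < \<gamma>" "\<gamma> \<le> pi" "0 \<le> u" "u < v" "v \<le> pi"
    and "\<And>x. u < x \<Longrightarrow> x < v \<Longrightarrow> force A C \<gamma> x < 0"
  shows "energy A C \<gamma> v < energy A C \<gamma> u"
proof (rule DERIV_neg_imp_decreasing_open [OF \<open>u < v\<close>])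
  fix x assume "u < x" "x < v"
  with assms have "force A C \<gamma> x * (sin x + sin ((x + \<gamma>) / 2) / C) < 0"
    by (intro mult_neg_pos energy_factor_pos) auto
  then show "\<exists>y. (energy A C \<gamma> has_real_derivative y) (at x) \<and> y < 0"
    using DERIV_energy assms(1) by (metis less_irrefl)
qed (use assms(1) in \<open>auto intro: continuous_on_energy\<close>)

section \<open>Sign and monotonicity of the derivative of the force\<close>

text \<open>Here x + \<gamma> stays in [0, pi], while x and (x + \<gamma>)/2 stay in [0, pi/2].
  There sines increase, cosines decrease and all are nonnegative, so no summand of
  \<open>force'\<close> decreases; strictness comes from the cosine of x + \<gamma>.\<close>

lemma force'_strict_mono_left:
  assumes "0 < C" "pi / 2 < \<gamma>" "0 \<le> u" "u < v" "v \<le> pi - \<gamma>"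
  shows "force' C \<gamma> u < force' C \<gamma> v"
proof -
  have "cos (v + \<gamma>) < cos (u + \<gamma>)"
    using assms by (intro cos_monotone_0_pi) auto
  moreover have sin: "sin u \<le> sin v" "sin ((u + \<gamma>) / 2) \<le> sin ((v + \<gamma>) / 2)"
    using assms by (auto intro!: sin_monotone_2pi_le)
  moreover have cos: "cos v \<le> cos u" "cos ((v + \<gamma>) / 2) \<le> cos ((u + \<gamma>) / 2)"
    using assms by (auto intro!: cos_monotone_0_pi_le)
  moreover have nonneg: "0 \<le> sin u" "0 \<le> sin ((u + \<gamma>) / 2)" "0 \<le> cos v" "0 \<le> cos ((v + \<gamma>) / 2)"
    using assms by (auto intro!: sin_ge_zero cos_ge_zero)
  ultimately have
    "C\<^sup>2 * (sin u)\<^sup>2 \<le> C\<^sup>2 * (sin v)\<^sup>2"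
    "C * (sin ((u + \<gamma>) / 2) * sin u - 2 * (cos ((u + \<gamma>) / 2) * cos u))
      \<le> C * (sin ((v + \<gamma>) / 2) * sin v - 2 * (cos ((v + \<gamma>) / 2) * cos v))"
    using \<open>0 < C\<close> by (auto intro!: mult_left_mono power_mono diff_mono mult_mono)
  with \<open>cos (v + \<gamma>) < cos (u + \<gamma>)\<close> show ?thesis
    unfolding force'_def mult.assoc by linarith
qed

text \<open>Here x + \<gamma> lies in [pi, 2 pi], while x and (x + \<gamma>)/2 lie in [pi/2, pi].
  The sines are nonnegative and decrease; the cosines are nonpositive and decrease, so their product
  increases. Strictness again comes from the cosine of x + \<gamma>.\<close>

lemma force'_strict_mono_right:
  assumes "0 < C" "pi / 2 < \<gamma>" "\<gamma> \<le> pi" "pi / 2 \<le> u" "u < v" "v \<le> pi"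
  shows "force' C \<gamma> v < force' C \<gamma> u"
proof -
  have "cos (u + \<gamma>) < cos (v + \<gamma>)"
  proof -
    \<comment> \<open>Reflection at pi moves both arguments into [0, pi], where cosine is
      decreasing.\<close>
    have "cos (2 * pi - (u + \<gamma>)) < cos (2 * pi - (v + \<gamma>))"
      using assms by (intro cos_monotone_0_pi) auto
    then show ?thesis
      by (simp only: cos_2pi_minus)
  qed
  moreover have sin: "sin v \<le> sin u" "sin ((v + \<gamma>) / 2) \<le> sin ((u + \<gamma>) / 2)"
  proof -
    have "sin (pi - v) \<le> sin (pi - u)"
      by (rule sin_monotone_2pi_le) (use assms in auto)
    moreover have "sin (pi - (v + \<gamma>) / 2) \<le> sin (pi - (u + \<gamma>) / 2)"
    proof (rule sin_monotone_2pi_le)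
      have "0 \<le> pi - (v + \<gamma>) / 2"
        using assms by simp
      then show "- (pi / 2) \<le> pi - (v + \<gamma>) / 2"
        using pi_ge_zero by linarith
    qed (use assms in auto)
    ultimately show "sin v \<le> sin u" "sin ((v + \<gamma>) / 2) \<le> sin ((u + \<gamma>) / 2)"
      by (simp_all only: sin_pi_minus)
  qed
  moreover have cos: "cos v \<le> cos u" "cos ((v + \<gamma>) / 2) \<le> cos ((u + \<gamma>) / 2)"
    using assms by (auto intro!: cos_monotone_0_pi_le)
  moreover have nonneg: "0 \<le> sin v" "0 \<le> sin ((v + \<gamma>) / 2)" 
    using assms by (auto intro!: sin_ge_zero)
  moreover have nonpos: "cos u \<le> 0" "cos ((u + \<gamma>) / 2) \<le> 0"
    using assms cos_monotone_0_pi_le [of "pi / 2" u] cos_monotone_0_pi_le [of "pi / 2" "(u + \<gamma>) / 2"]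
    by auto
  \<comment> \<open>All factors are nonpositive, so \<open>mult_mono\<close> is applied to their
    negatives.\<close>
  moreover have "cos ((u + \<gamma>) / 2) * cos u \<le> cos ((v + \<gamma>) / 2) * cos v"
    using mult_mono [of "- cos ((u + \<gamma>) / 2)" "- cos ((v + \<gamma>) / 2)" "- cos u" "- cos v"]
      cos nonpos by simp
  ultimately have
    "C\<^sup>2 * (sin v)\<^sup>2 \<le> C\<^sup>2 * (sin u)\<^sup>2"
    "C * (sin ((v + \<gamma>) / 2) * sin v - 2 * (cos ((v + \<gamma>) / 2) * cos v))
      \<le> C * (sin ((u + \<gamma>) / 2) * sin u - 2 * (cos ((u + \<gamma>) / 2) * cos u))"
    using \<open>0 < C\<close> by (auto intro!: mult_left_mono power_mono diff_mono mult_mono)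
  with \<open>cos (u + \<gamma>) < cos (v + \<gamma>)\<close> show ?thesis
    unfolding force'_def mult.assoc by linarith
qed

text \<open>Since x + \<gamma> lies in [pi, 3 pi/2], its cosine and that of its half are
  nonpositive, so every summand of \<open>force'\<close> is nonnegative.\<close>

lemma force'_pos_middle:
  assumes "0 < C" "pi / 2 < \<gamma>" "\<gamma> \<le> pi" "pi - \<gamma> \<le> x" "x \<le> pi / 2"
  shows "0 < force' C \<gamma> x"
proof -
  have s: "0 \<le> sin x" "0 < sin ((x + \<gamma>) / 2)" "0 \<le> cos x"
    using assms by (auto intro!: sin_ge_zero sin_gt_zero cos_ge_zero)
  have c: "cos ((x + \<gamma>) / 2) \<le> 0"
    using assms cos_monotone_0_pi_le [of "pi / 2" "(x + \<gamma>) / 2"] by auto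
  have "cos (x + \<gamma>) \<le> 0"
  proof -
    have "0 \<le> cos (x + \<gamma> - pi)"
      using assms by (intro cos_ge_zero) auto
    then show ?thesis by simp
  qed
  moreover have "0 \<le> sin ((x + \<gamma>) / 2) * sin x" "cos ((x + \<gamma>) / 2) * cos x \<le> 0"
    using s c by (auto simp: mult_nonpos_nonneg)
  then have "0 \<le> C * (sin ((x + \<gamma>) / 2) * sin x - 2 * (cos ((x + \<gamma>) / 2) * cos x))"
    using \<open>0 < C\<close> by simp
  \<comment> \<open>Strictness: x = 0 forces \<gamma> = pi, where -cos(x + \<gamma>) = 1; for any
    other x the sine of x is positive.\<close>
  moreover have "0 < - cos (x + \<gamma>) \<or> 0 < C\<^sup>2 * (sin x)\<^sup>2"
  proof (cases "x = 0")
    case True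
    then have "\<gamma> = pi" using assms by simp
    with True show ?thesis by simp
  next
    case False
    then have "0 < sin x"
      using assms by (intro sin_gt_zero) auto
    with \<open>0 < C\<close> show ?thesis by simp
  qed
  moreover have "0 \<le> C\<^sup>2 * (sin x)\<^sup>2"
    by simp
  ultimately show ?thesis
    unfolding force'_def mult.assoc by linarith
qed

text \<open>The value is 2 cos \<gamma> - 4 C sin(\<gamma>/2), and both terms are negative for
  \<gamma> in (pi/2, pi].\<close>

lemma force'_pi_neg:
  assumes "0 < C" "pi / 2 < \<gamma>" "\<gamma> \<le> pi"
  shows "force' C \<gamma> pi < 0"
proof -
  have "cos (pi + \<gamma>) = - cos \<gamma>" "cos ((pi + \<gamma>) / 2) = - sin (\<gamma> / 2)"
    by (simp_all add: cos_add add_divide_distrib)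
  moreover have "cos \<gamma> < 0"
    using assms cos_monotone_0_pi [of "pi / 2" \<gamma>] by auto
  moreover have "0 < C * sin (\<gamma> / 2)"
    using assms by (intro mult_pos_pos sin_gt_zero) auto
  ultimately show ?thesis
    by (simp add: force'_def)
qed

section \<open>Shape of the force\<close>

lemma continuous_on_force': "continuous_on S (force' C \<gamma>)"
  unfolding force'_def [abs_def] by (intro continuous_intros) auto

lemma continuous_on_force: "continuous_on S (force A C \<gamma>)"
  by (intro continuous_at_imp_continuous_on ballI DERIV_isCont [OF DERIV_force])

lemma force_increasing:
  assumes "u < v" "\<And>x. u < x \<Longrightarrow> x < v \<Longrightarrow> 0 < force' C \<gamma> x"
  shows "force A C \<gamma> u < force A C \<gamma> v"
proof (rule DERIV_pos_imp_increasing_open [OF assms(1) _ continuous_on_force])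
qed (use assms(2) DERIV_force in blast)

lemma force_decreasing:
  assumes "u < v" "\<And>x. u < x \<Longrightarrow> x < v \<Longrightarrow> force' C \<gamma> x < 0"
  shows "force A C \<gamma> v < force A C \<gamma> u"
proof (rule DERIV_neg_imp_decreasing_open [OF assms(1) _ continuous_on_force])
qed (use assms(2) DERIV_force in blast)

text \<open>At 0 the force is -A C^2 - 2 sin \<gamma> < 0, and it does not rise above this value on
  [0, a]. The point \<open>b\<close> is a zero of \<open>force'\<close> between pi/2 and pi, given
  by the intermediate value theorem.\<close>

lemma force_shape:
  assumes "0 < A" "0 < C" "pi / 2 < \<gamma>" "\<gamma> \<le> pi"
  obtains a b where "0 \<le> a" "a < pi / 2" "pi / 2 < b" "b < pi"
    and "\<And>x. 0 \<le> x \<Longrightarrow> x \<le> a \<Longrightarrow> force A C \<gamma> x < 0"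
    and "\<And>x. a < x \<Longrightarrow> x < b \<Longrightarrow> 0 < force' C \<gamma> x"
    and "\<And>x. b < x \<Longrightarrow> x \<le> pi \<Longrightarrow> force' C \<gamma> x < 0"
    and "force' C \<gamma> b = 0"
proof -
  have f0: "force A C \<gamma> 0 < 0"
  proof -
    have "0 \<le> sin \<gamma>"
      using assms by (intro sin_ge_zero) auto
    moreover have "0 < A * C\<^sup>2"
      using assms by simp
    ultimately show ?thesis
      by (simp add: force_def)
  qed
  have mid: "0 < force' C \<gamma> (pi - \<gamma>)" "0 < force' C \<gamma> (pi / 2)"
    using assms by (auto intro!: force'_pos_middle)
  obtain b where b: "pi / 2 \<le> b" "b \<le> pi" "force' C \<gamma> b = 0"
    using IVT2' [of "force' C \<gamma>" pi 0 "pi / 2", OF _ _ _ continuous_on_force']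
      mid force'_pi_neg [OF assms(2-4)] by (auto simp: field_simps)
  have b': "pi / 2 < b" "b < pi"
  proof -
    have "b \<noteq> pi / 2" "b \<noteq> pi"
      using b(3) mid(2) force'_pi_neg [OF assms(2-4)] by (metis less_irrefl)+
    with b show "pi / 2 < b" "b < pi"
      by simp_all
  qed
  \<comment> \<open>The witness is 0 if \<open>force'\<close> is nonnegative at 0, and otherwise a
    zero of \<open>force'\<close> in [0, pi - \<gamma>]. Strict monotonicity of
    \<open>force'\<close> gives its signs on either side.\<close>
  have "\<exists>a\<ge>0. a \<le> pi - \<gamma> \<and> force A C \<gamma> a < 0 \<and> (\<forall>x. 0 \<le> x \<and> x < a \<longrightarrow> force' C \<gamma> x < 0)
    \<and> (\<forall>x. a < x \<and> x \<le> pi - \<gamma> \<longrightarrow> 0 < force' C \<gamma> x)"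
  proof (cases "0 \<le> force' C \<gamma> 0")
    case True
    then have "0 < force' C \<gamma> x" if "0 < x" "x \<le> pi - \<gamma>" for x
      using force'_strict_mono_left [of C \<gamma> 0 x] assms that by auto
    with f0 assms show ?thesis
      by (intro exI [of _ 0]) auto
  next
    case False
    then obtain a where a: "0 \<le> a" "a \<le> pi - \<gamma>" "force' C \<gamma> a = 0"
      using IVT' [of "force' C \<gamma>" 0 0 "pi - \<gamma>", OF _ _ _ continuous_on_force'] mid assms
      by (metis diff_ge_0_iff_ge less_imp_le not_le)
    have neg: "force' C \<gamma> x < 0" if "0 \<le> x" "x < a" for x
      using force'_strict_mono_left [of C \<gamma> x a] assms a that by auto
    moreover have "0 < force' C \<gamma> x" if "a < x" "x \<le> pi - \<gamma>" for x
      using force'_strict_mono_left [of C \<gamma> a x] assms a that by auto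
    moreover have "force A C \<gamma> a < 0"
    proof -
      have "0 < a"
        using a False by (cases "a = 0") auto
      then have "force A C \<gamma> a < force A C \<gamma> 0"
        using neg by (intro force_decreasing) auto
      with f0 show ?thesis by simp
    qed
    ultimately show ?thesis
      using a by blast
  qed
  then obtain a where a: "0 \<le> a" "a \<le> pi - \<gamma>" "force A C \<gamma> a < 0"
    and left: "\<And>x. 0 \<le> x \<Longrightarrow> x < a \<Longrightarrow> force' C \<gamma> x < 0"
    and right: "\<And>x. a < x \<Longrightarrow> x \<le> pi - \<gamma> \<Longrightarrow> 0 < force' C \<gamma> x"
    by blast
  show thesis
  proof (rule that [of a b])
    show "a < pi / 2"
      using a assms by simp
    show "force A C \<gamma> x < 0" if "0 \<le> x" "x \<le> a" for x
    proof (cases "x = 0")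
      case False
      then have "force A C \<gamma> x < force A C \<gamma> 0"
        using that left by (intro force_decreasing) auto
      with f0 show ?thesis by simp
    qed (use f0 in simp)
    show "0 < force' C \<gamma> x" if "a < x" "x < b" for x
    proof -
      \<comment> \<open>On the last range \<open>force'\<close> decreases strictly to its value 0 at
        \<open>b\<close>, hence is positive before \<open>b\<close>.\<close>
      consider "x \<le> pi - \<gamma>" | "pi - \<gamma> \<le> x" "x \<le> pi / 2" | "pi / 2 \<le> x"
        by linarith
      then show ?thesis
      proof cases
        case 3
        then show ?thesis
          using force'_strict_mono_right [of C \<gamma> x b] b that assms by simp
      qed (use right that assms force'_pos_middle in auto)
    qed
    show "force' C \<gamma> x < 0" if "b < x" "x \<le> pi" for x
      using force'_strict_mono_right [of C \<gamma> b x] b that assms by simp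
  qed (use a b b' in auto)
qed

section \<open>Criteria for local minima\<close>

lemma strict_local_min_onI:
  fixes f :: "real \<Rightarrow> real"
  assumes "x \<in> S" "u < x" "x < v" "\<And>y. u < y \<Longrightarrow> y < v \<Longrightarrow> y \<noteq> x \<Longrightarrow> f x < f y"
  shows "strict_local_min_on S f x"
proof -
  have "\<forall>\<^sub>F y in nhds x. y \<in> {u<..<v}"
    using assms by (intro eventually_nhds_in_open) auto
  then show ?thesis
    unfolding strict_local_min_on_def eventually_at_filter
    using assms by (auto elim!: eventually_mono)
qed

text \<open>Strict descent on one side suffices, even if x is an end point of S: a local minimum
  would survive restriction to \<open>at_left x\<close>, and this filter is nontrivial.\<close>

lemma not_local_min_onI_left:
  fixes f :: "real \<Rightarrow> real"
  assumes "u < x" "{u..x} \<subseteq> S" "\<And>y. u < y \<Longrightarrow> y < x \<Longrightarrow> f y < f x"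
  shows "\<not> local_min_on S f x"
proof
  assume "local_min_on S f x"
  then have "\<forall>\<^sub>F y in at x within S. f x \<le> f y"
    by (simp add: local_min_on_def)
  then have "\<forall>\<^sub>F y in at x within {u..x}. f x \<le> f y"
    using at_le [OF assms(2)] filter_leD by blast
  then have "\<forall>\<^sub>F y in at_left x. f x \<le> f y"
    using assms(1) by (simp add: at_within_Icc_at_left)
  moreover have "\<forall>\<^sub>F y in at_left x. f y < f x"
    using eventually_at_left_real [OF assms(1)] by eventually_elim (simp add: assms(3))
  ultimately have "\<forall>\<^sub>F y in at_left x. False"
    by eventually_elim simp
  then show False by simp
qed

lemma not_local_min_onI_right:
  fixes f :: "real \<Rightarrow> real"
  assumes "x < u" "{x..u} \<subseteq> S" "\<And>y. x < y \<Longrightarrow> y < u \<Longrightarrow> f y < f x"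
  shows "\<not> local_min_on S f x"
proof
  assume "local_min_on S f x"
  then have "\<forall>\<^sub>F y in at x within S. f x \<le> f y"
    by (simp add: local_min_on_def)
  then have "\<forall>\<^sub>F y in at x within {x..u}. f x \<le> f y"
    using at_le [OF assms(2)] filter_leD by blast
  then have "\<forall>\<^sub>F y in at_right x. f x \<le> f y"
    using assms(1) by (simp add: at_within_Icc_at_right)
  moreover have "\<forall>\<^sub>F y in at_right x. f y < f x"
    using eventually_at_right_real [OF assms(1)] by eventually_elim (simp add: assms(3))
  ultimately have "\<forall>\<^sub>F y in at_right x. False"
    by eventually_elim simp
  then show False by simp
qed

section \<open>Classification of the equilibria\<close>

text \<open>The force is injective on [a, b] and on [b, pi] and has no zero in [0, a], so two
  equilibria lie strictly on opposite sides of \<open>b\<close>. Left of \<open>b\<close> the force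
  passes from negative to positive, which gives a strict minimum of the energy.\<close>

lemma equilibria_dichotomy:
  assumes "0 < A" "0 < C" "pi / 2 < \<gamma>" "\<gamma> \<le> pi"
  obtains b where "pi / 2 < b"
    and "\<And>x y. x \<in> equilibria A C \<gamma> \<Longrightarrow> y \<in> equilibria A C \<gamma> \<Longrightarrow> x < y \<Longrightarrow> x < b \<and> b < y"
    and "\<And>x. x \<in> equilibria A C \<gamma> \<Longrightarrow> x < b \<Longrightarrow>
      stable_equilibrium A C \<gamma> x \<and> 0 < force' C \<gamma> x"
    and "\<And>x. x \<in> equilibria A C \<gamma> \<Longrightarrow> b \<le> x \<Longrightarrow>
      unstable_equilibrium A C \<gamma> x \<and> force' C \<gamma> x \<le> 0"
proof -
  obtain a b where ab: "0 \<le> a" "a < pi / 2" "pi / 2 < b" "b < pi" "force' C \<gamma> b = 0"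
    and neg: "\<And>x. 0 \<le> x \<Longrightarrow> x \<le> a \<Longrightarrow> force A C \<gamma> x < 0"
    and inc: "\<And>x. a < x \<Longrightarrow> x < b \<Longrightarrow> 0 < force' C \<gamma> x"
    and dec: "\<And>x. b < x \<Longrightarrow> x \<le> pi \<Longrightarrow> force' C \<gamma> x < 0"
    using force_shape [OF assms] by metis
  have up: "force A C \<gamma> u < force A C \<gamma> v" if "a \<le> u" "u < v" "v \<le> b" for u v
    using that inc by (intro force_increasing) auto
  have down: "force A C \<gamma> v < force A C \<gamma> u" if "b \<le> u" "u < v" "v \<le> pi" for u v
    using that dec by (intro force_decreasing) auto
  have eq: "force A C \<gamma> x = 0" "a < x" "x \<le> pi" if "x \<in> equilibria A C \<gamma>" for x
    using that neg [of x] by (auto simp: equilibria_def not_le [symmetric])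
  show thesis
  proof (rule that [OF \<open>pi / 2 < b\<close>])
    fix x y assume "x \<in> equilibria A C \<gamma>" "y \<in> equilibria A C \<gamma>" "x < y"
    then show "x < b \<and> b < y"
      using eq [of x] eq [of y] up [of x y] down [of x y] by fastforce
  next
    fix x assume x: "x \<in> equilibria A C \<gamma>" "x < b"
    have "strict_local_min_on {0..pi} (energy A C \<gamma>) x"
    proof (rule strict_local_min_onI [of _ _ a b])
      fix y assume y: "a < y" "y < b" "y \<noteq> x"
      show "energy A C \<gamma> x < energy A C \<gamma> y"
      proof (cases "y < x")
        case True
        have "force A C \<gamma> z < 0" if "y < z" "z < x" for z
          using up [of z x] eq [of x] x y that by simp
        with True show ?thesis
          using ab assms y eq [of x] x by (intro energy_decreasing) auto
      next
        case False
        have "0 < force A C \<gamma> z" if "x < z" "z < y" for z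
          using up [of x z] eq [of x] x y that by simp
        with False show ?thesis
          using ab assms y eq [of x] x by (intro energy_increasing) auto
      qed
    qed (use x eq [of x] ab in auto)
    then show "stable_equilibrium A C \<gamma> x \<and> 0 < force' C \<gamma> x"
      using x inc [of x] eq [of x] by (simp add: stable_equilibrium_def)
  next
    fix x assume x: "x \<in> equilibria A C \<gamma>" "b \<le> x"
    have "\<not> local_min_on {0..pi} (energy A C \<gamma>) x"
    \<comment> \<open>If x = b, the force has maximal value 0 there and is negative to the right, so
      the energy falls after x. If x > b, the force is positive between \<open>b\<close> and x, so
      the energy is smaller just before x.\<close>
    proof (cases "x = b")
      case True
      show ?thesis
      proof (rule not_local_min_onI_right [of _ pi])
        fix y assume y: "x < y" "y < pi"
        have "force A C \<gamma> z < 0" if "x < z" "z < y" for z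
          using down [of x z] eq [of x] x y that by simp
        then show "energy A C \<gamma> y < energy A C \<gamma> x"
          using ab assms y x by (intro energy_decreasing) auto
      qed (use True ab in auto)
    next
      case False
      show ?thesis
      proof (rule not_local_min_onI_left [of b])
        fix y assume y: "b < y" "y < x"
        have "0 < force A C \<gamma> z" if "y < z" "z < x" for z
          using down [of z x] eq [of x] x y that by simp
        then show "energy A C \<gamma> y < energy A C \<gamma> x"
          using ab assms y eq [of x] x by (intro energy_increasing) auto
      qed (use False x ab eq [of x] in auto)
    qed
    then show "unstable_equilibrium A C \<gamma> x \<and> force' C \<gamma> x \<le> 0"
      using x dec [of x] eq [of x] ab by (cases "x = b") (auto simp: unstable_equilibrium_def)
  qed
qed

theorem mainTheorem5:
  fixes A C \<gamma> :: real
  assumes "A > 0" and "C > 0" and "\<gamma> \<in> {pi / 2 <.. pi}"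
  shows "finite (equilibria A C \<gamma>) \<and> card (equilibria A C \<gamma>) \<le> 2 \<and>
    (\<forall>\<phi>1 \<phi>2. equilibria A C \<gamma> = {\<phi>1, \<phi>2} \<and> \<phi>1 < \<phi>2 \<longrightarrow>
       stable_equilibrium A C \<gamma> \<phi>1 \<and> unstable_equilibrium A C \<gamma> \<phi>2 \<and> \<phi>2 \<in> {pi / 2 <.. pi}) \<and>
    (\<forall>\<phi>. equilibria A C \<gamma> = {\<phi>} \<longrightarrow>
       (deriv (force A C \<gamma>) \<phi> > 0 \<longrightarrow> stable_equilibrium A C \<gamma> \<phi>) \<and>
       (deriv (force A C \<gamma>) \<phi> = 0 \<longrightarrow> unstable_equilibrium A C \<gamma> \<phi>))"
proof -
  let ?Z = "equilibria A C \<gamma>"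
  obtain b where "pi / 2 < b"
    and sep: "\<And>x y. x \<in> ?Z \<Longrightarrow> y \<in> ?Z \<Longrightarrow> x < y \<Longrightarrow> x < b \<and> b < y"
    and stable: "\<And>x. x \<in> ?Z \<Longrightarrow> x < b \<Longrightarrow> stable_equilibrium A C \<gamma> x \<and> 0 < force' C \<gamma> x"
    and unstable: "\<And>x. x \<in> ?Z \<Longrightarrow> b \<le> x \<Longrightarrow> unstable_equilibrium A C \<gamma> x \<and> force' C \<gamma> x \<le> 0"
    using equilibria_dichotomy [of A C \<gamma>] assms by auto
  \<comment> \<open>Each side of \<open>b\<close> holds at most one equilibrium, so comparison with
    \<open>b\<close> embeds the equilibria into the two-element type \<open>bool\<close>.\<close>
  have inj: "inj_on (\<lambda>x. x < b) ?Z"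
    by (rule linorder_inj_onI') (use sep in fastforce)
  then have fin: "finite ?Z"
    by (rule inj_on_finite [of _ _ UNIV]) auto
  have card: "card ?Z \<le> 2"
    using card_inj_on_le [OF inj, of UNIV] by simp
  have two: "stable_equilibrium A C \<gamma> x \<and> unstable_equilibrium A C \<gamma> y \<and> y \<in> {pi / 2 <.. pi}"
    if "?Z = {x, y}" "x < y" for x y
  proof -
    have xy: "x \<in> ?Z" "y \<in> ?Z"
      using that by auto
    with sep [OF xy \<open>x < y\<close>] stable [of x] unstable [of y] \<open>pi / 2 < b\<close> show ?thesis
      by (auto simp: equilibria_def)
  qed
  \<comment> \<open>The sign of the derivative decides the side of \<open>b\<close>: a positive
    value excludes b \<le> x, and the value 0 excludes x < b.\<close>
  have one: "(0 < deriv (force A C \<gamma>) x \<longrightarrow> stable_equilibrium A C \<gamma> x) \<and>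
      (deriv (force A C \<gamma>) x = 0 \<longrightarrow> unstable_equilibrium A C \<gamma> x)" if "?Z = {x}" for x
    using stable [of x] unstable [of x] that by (cases "x < b") (auto simp: deriv_force)
  show ?thesis
    using fin card two one by blast
qed

end
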